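(* Let $G=(V,E)$ be a weakly connected directed graph with $n$ vertices and $m$ edges in which at least $n/\alpha$ vertices have nonzero indegree. Then there exists a spanning tree $T$ of $G$ such that \[ H(G-T)\le H(G)-\frac{n}{2\alpha}\,\mathcal{H}(G)+\frac{2n}{\ln 2}. \]
   Context: A spanning tree of a directed graph is a set of edges forming a spanning tree of the underlying undirected graph (orientations ignored); $G-T$ denotes $G$ with the edges of $T$ removed. With $d_v$ the indegree of $v$ and $m$ the number of edges, $H(G)=\sum_v d_v\lg(m/d_v)$ and $\mathcal{H}(G)=\sum_v \frac{d_v}{m}\lg\frac{m}{d_v}=H(G)/m$, with $0\lg(\cdot/0)=0$, $\lg=\log_2$. *)

theory Defs
  imports Complex_Main "Graph_Theory.Graph_Theory"
begin

text \<open>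
  \<open>Digraph_Component.connected\<close> is weak connectivity (of a nonempty digraph), but
  \<open>Digraph_Component.forest\<close>, and with it \<open>tree\<close> and \<open>spanning_tree\<close>, only
  excludes directed cycles: every weakly connected acyclic digraph is a \<open>tree\<close> there.
  Spanning trees of the underlying undirected graph therefore need a notion of cycle that ignores
  orientations. In \<open>bidirect G\<close> every arc can be traversed both ways: \<open>(e, True)\<close>
  forwards and \<open>(e, False)\<close> backwards.
\<close>

definition bidirect :: "('a, 'b) pre_digraph \<Rightarrow> ('a, 'b \<times> bool) pre_digraph" where
  "bidirect G = \<lparr> verts = verts G, arcs = arcs G \<times> UNIV,
     tail = (\<lambda>(e, fwd). if fwd then tail G e else head G e),
     head = (\<lambda>(e, fwd). if fwd then head G e else tail G e) \<rparr>"

text \<open>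
  Distinctness of the arcs rules out going back and forth along a single arc. Two antiparallel arcs
  do form an undirected cycle, so a spanning tree contains at most one of them.
\<close>

definition undirected_cycle :: "('a, 'b) pre_digraph \<Rightarrow> ('b \<times> bool) list \<Rightarrow> bool" where
  "undirected_cycle G p \<longleftrightarrow> pre_digraph.cycle (bidirect G) p \<and> distinct (map fst p)"

definition undirected_tree :: "('a, 'b) pre_digraph \<Rightarrow> bool" where
  "undirected_tree G \<longleftrightarrow> Digraph_Component.connected G \<and> (\<nexists>p. undirected_cycle G p)"

definition undirected_spanning_tree :: "('a, 'b) pre_digraph \<Rightarrow> 'b set \<Rightarrow> bool" where
  "undirected_spanning_tree G T \<longleftrightarrow> T \<subseteq> arcs G \<and> undirected_tree (G\<lparr>arcs := T\<rparr>)"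

definition del_arcs :: "('a, 'b) pre_digraph \<Rightarrow> 'b set \<Rightarrow> ('a, 'b) pre_digraph" where
  "del_arcs G T = G\<lparr>arcs := arcs G - T\<rparr>"

text \<open>
  \<open>total_degree_entropy\<close> is \<open>H(G)\<close>, \<open>degree_entropy\<close> is its normalized
  version. A vertex of indegree \<open>0\<close> contributes \<open>0\<close> because of the factor \<open>0\<close>.
\<close>

definition total_degree_entropy :: "('a, 'b) pre_digraph \<Rightarrow> real" where
  "total_degree_entropy G = (\<Sum>v\<in>verts G. real (in_degree G v) *
     log 2 (real (card (arcs G)) / real (in_degree G v)))"

definition degree_entropy :: "('a, 'b) pre_digraph \<Rightarrow> real" where
  "degree_entropy G = (\<Sum>v\<in>verts G. real (in_degree G v) / real (card (arcs G)) *
     log 2 (real (card (arcs G)) / real (in_degree G v)))"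

lemma degree_entropy_eq: "degree_entropy G = total_degree_entropy G / real (card (arcs G))"
  by (simp add: degree_entropy_def total_degree_entropy_def sum_divide_distrib)

end

theory Submission
  imports Defs
begin

text \<open>
  Gibbs' inequality gives \<open>H(G - T) \<le> H(G) - (\<Sum>e\<in>T. lg (m / d (head e)))\<close> for every set
  \<open>T\<close> of arcs, so it suffices to find a heavy spanning tree. Choose one incoming arc for each
  of the \<open>k\<close> vertices of nonzero indegree and split the chosen arcs by whether the head
  precedes the tail in a fixed linear order of the vertices. Both classes are forests, one of them
  carries at least half of the total weight \<open>\<Sum>v. lg (m / d v)\<close>, and any forest extends to a
  spanning tree. By Chebyshev's sum inequality the total weight is at least \<open>k\<close> times the
  normalized entropy.
\<close>

section \<open>Undirected forests and spanning trees\<close>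

lemma bidirect_simps [simp]:
  "verts (bidirect G) = verts G"
  "arcs (bidirect G) = arcs G \<times> UNIV"
  "tail (bidirect G) (e, b) = (if b then tail G e else head G e)"
  "head (bidirect G) (e, b) = (if b then head G e else tail G e)"
  by (simp_all add: bidirect_def)

lemma wf_digraph_bidirect: "wf_digraph G \<Longrightarrow> wf_digraph (bidirect G)"
  unfolding wf_digraph_def by auto

lemma arcs_ends_bidirect: "arcs_ends (bidirect G) = parcs (mk_symmetric G)"
  by (force simp: arcs_ends_conv mk_symmetric_def)

text \<open>Reachability depends only on pairs of endpoints, and these agree for
  \<open>bidirect G\<close> and \<open>mk_symmetric G\<close>. Hence connectivity and undirected
  cycles can both be studied in \<open>bidirect G\<close>, which also records which arc is
  traversed.\<close>

lemma connected_iff_bidirect: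
  "Digraph_Component.connected G \<longleftrightarrow> strongly_connected (bidirect G)"
  by (simp add: connected_def strongly_connected_def reachable_def arcs_ends_bidirect)

lemma symmetric_bidirect: "symmetric (bidirect G)"
  by (auto simp: symmetric_def arcs_ends_bidirect mk_symmetric_def sym_def)

lemma wf_digraph_arcs_update:
  "wf_digraph G \<Longrightarrow> T \<subseteq> arcs G \<Longrightarrow> wf_digraph (G\<lparr>arcs := T\<rparr>)"
  unfolding wf_digraph_def by auto

lemma compatible_bidirect_arcs_update:
  "compatible (bidirect (G\<lparr>arcs := T\<rparr>)) (bidirect G)"
  by (simp add: compatible_def bidirect_def fun_eq_iff)

text \<open>The walk conditions depend only on heads and tails, which restricting the arcs leaves
  unchanged. Thus \<open>T\<close> enters only through a containment, and cycles can be moved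
  between arc sets.\<close>

lemma undirected_cycle_arcs_update_iff:
  "undirected_cycle (G\<lparr>arcs := T\<rparr>) p \<longleftrightarrow>
    (\<exists>u\<in>verts G. pre_digraph.cas (bidirect G) u p u \<and>
      distinct (tl (pre_digraph.awalk_verts (bidirect G) u p))) \<and>
      fst ` set p \<subseteq> T \<and> p \<noteq> [] \<and> distinct (map fst p)"
  using compatible_bidirect_arcs_update[where G = G and T = T]
  unfolding undirected_cycle_def pre_digraph.cycle_def pre_digraph.awalk_def
  by (force simp: compatible_cas compatible_awalk_verts)

section \<open>Extending forests to spanning trees\<close>

text \<open>The rest of the cycle is a detour around the deleted arc.\<close>

lemma connected_delete_cycle_arc:
  assumes wf: "wf_digraph G" and con: "Digraph_Component.connected G"
    and cyc: "undirected_cycle G p" and e: "e \<in> fst ` set p"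
  shows "Digraph_Component.connected (G\<lparr>arcs := arcs G - {e}\<rparr>)"
proof -
  define H where "H = G\<lparr>arcs := arcs G - {e}\<rparr>"
  interpret B: wf_digraph "bidirect G" using wf by (rule wf_digraph_bidirect)
  have "wf_digraph H"
    unfolding H_def by (rule wf_digraph_arcs_update[OF wf]) auto
  then interpret B': wf_digraph "bidirect H" by (rule wf_digraph_bidirect)
  have ends: "head (bidirect H) = head (bidirect G)" "tail (bidirect H) = tail (bidirect G)"
    unfolding H_def using compatible_bidirect_arcs_update
    by (metis compatible_head compatible_tail)+
  have cas: "B'.cas = B.cas"
    unfolding H_def by (rule compatible_cas[OF compatible_bidirect_arcs_update])
  obtain u where u: "B.awalk u p u"
    using cyc unfolding undirected_cycle_def B.cycle_def by blast
  have dist: "distinct (map fst p)"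
    using cyc unfolding undirected_cycle_def by blast
  obtain a where a: "a \<in> set p" "fst a = e" using e by auto
  then obtain xs ys where p: "p = xs @ a # ys" by (meson split_list)
  \<comment> \<open>Rotating the cycle so that it starts after \<open>a\<close> yields the detour
    \<open>ys @ xs\<close>.\<close>
  have "B.awalk (head (bidirect G) a) (ys @ xs) (tail (bidirect G) a)"
    using u unfolding p B.awalk_append_iff B.awalk_Cons_iff
    by (metis B.awlast_of_awalk B.awalk_append_iff B.awalk_def B.awlast_if_cas)
  \<comment> \<open>As the underlying arcs are distinct, the detour uses \<open>e\<close> in neither
    direction.\<close>
  moreover have "e \<notin> fst ` set (ys @ xs)" using dist a p by auto
  ultimately have "B'.awalk (head (bidirect G) a) (ys @ xs) (tail (bidirect G) a)"
    unfolding B.awalk_def B'.awalk_def cas by (force simp: H_def)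
  then have head_tail: "head (bidirect G) a \<rightarrow>\<^sup>*\<^bsub>bidirect H\<^esub> tail (bidirect G) a"
    by (rule B'.reachable_awalkI)
  then have tail_head: "tail (bidirect G) a \<rightarrow>\<^sup>*\<^bsub>bidirect H\<^esub> head (bidirect G) a"
    by (rule symmetric_reachable[OF symmetric_bidirect])
  have arc_reachable: "x \<rightarrow>\<^sup>*\<^bsub>bidirect H\<^esub> y" if "x \<rightarrow>\<^bsub>bidirect G\<^esub> y" for x y
  proof -
    from that obtain c
      where c: "c \<in> arcs (bidirect G)" "tail (bidirect G) c = x" "head (bidirect G) c = y"
      by (rule reachableE)
    show ?thesis
    proof (cases "fst c = e")
      \<comment> \<open>\<open>c\<close> is \<open>a\<close> or its reversal, so the detour is
        needed in both directions.\<close>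
      case True
      then show ?thesis using c a head_tail tail_head
        by (cases a; cases c) (auto split: if_splits)
    next
      case False
      then have "c \<in> arcs (bidirect H)" using c by (cases c) (auto simp: H_def)
      then have "x \<rightarrow>\<^bsub>bidirect H\<^esub> y"
        using c B'.in_arcs_imp_in_arcs_ends ends by metis
      then show ?thesis by (rule B'.reachable_adjI)
    qed
  qed
  have "x \<rightarrow>\<^sup>*\<^bsub>bidirect H\<^esub> y" if "x \<rightarrow>\<^sup>*\<^bsub>bidirect G\<^esub> y" for x y
    using that
  proof (induction rule: B.reachable_induct)
    case base
    then show ?case by (intro B'.reachable_refl) (simp add: H_def)
  next
    case (step y z)
    then show ?case using arc_reachable B'.reachable_trans by blast
  qed
  then have "Digraph_Component.connected H"
    using con unfolding connected_iff_bidirect strongly_connected_def by (simp add: H_def)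
  then show ?thesis unfolding H_def .
qed

text \<open>Take a minimal connected arc set containing \<open>F\<close>. A cycle in it cannot lie
  inside \<open>F\<close>, so it has an arc outside \<open>F\<close> whose deletion keeps the set
  connected, against minimality.\<close>

lemma forest_extends_to_spanning_tree:
  assumes wf: "wf_digraph G" and fin: "finite (arcs G)" and con: "Digraph_Component.connected G"
    and F: "F \<subseteq> arcs G" "\<nexists>p. undirected_cycle (G\<lparr>arcs := F\<rparr>) p"
  obtains T where "F \<subseteq> T" "undirected_spanning_tree G T"
proof -
  let ?C = "{T. F \<subseteq> T \<and> T \<subseteq> arcs G \<and> Digraph_Component.connected (G\<lparr>arcs := T\<rparr>)}"
  have "finite ?C" using fin by (rule_tac finite_subset[of _ "Pow (arcs G)"]) auto
  moreover have "arcs G \<in> ?C" using F con by simp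
  ultimately obtain T where T: "T \<in> ?C" and min: "\<And>T'. T' \<in> ?C \<Longrightarrow> T' \<subseteq> T \<Longrightarrow> T' = T"
    using finite_has_minimal[of ?C] by (metis (no_types, lifting) empty_iff)
  have "\<nexists>p. undirected_cycle (G\<lparr>arcs := T\<rparr>) p"
  proof
    assume "\<exists>p. undirected_cycle (G\<lparr>arcs := T\<rparr>) p"
    then obtain p where p: "undirected_cycle (G\<lparr>arcs := T\<rparr>) p" ..
    then have "\<not> fst ` set p \<subseteq> F" and pT: "fst ` set p \<subseteq> T"
      using F(2) unfolding undirected_cycle_arcs_update_iff by blast+
    then obtain e where e: "e \<in> fst ` set p" "e \<notin> F" by blast
    have "Digraph_Component.connected (G\<lparr>arcs := T - {e}\<rparr>)"
      using connected_delete_cycle_arc[OF wf_digraph_arcs_update[OF wf, of T] _ p e(1)] T by simp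
    then have "T - {e} \<in> ?C" using T e by auto
    then have "T - {e} = T" using min by blast
    then show False using e pT by auto
  qed
  then have "undirected_spanning_tree G T"
    using T unfolding undirected_spanning_tree_def undirected_tree_def by blast
  with T show ?thesis using that by blast
qed

section \<open>Acyclicity from a ranking of the vertices\<close>

lemma (in wf_digraph) closed_cas_tails_eq_heads:
  assumes "cas u p u"
  shows "tail G ` set p = head G ` set p"
proof (cases "p = []")
  case False
  \<comment> \<open>The induction needs walks with distinct ends. For \<open>u = v\<close> it leaves
    \<open>u\<close> inserted on both sides, and the next fact absorbs it.\<close>
  have "cas u p v \<Longrightarrow> insert v (tail G ` set p) = insert u (head G ` set p)" for u v
    by (induction p arbitrary: u) auto
  then have eq: "insert u (tail G ` set p) = insert u (head G ` set p)" using assms by blast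
  have "cas v p u \<Longrightarrow> p \<noteq> [] \<Longrightarrow> v \<in> tail G ` set p \<and> u \<in> head G ` set p" for v
  proof (induction p arbitrary: v)
    case (Cons a p)
    then show ?case by (cases "p = []") auto
  qed simp
  then have "u \<in> tail G ` set p" "u \<in> head G ` set p" using assms False by blast+
  with eq show ?thesis by (simp add: insert_absorb)
qed simp

text \<open>
  The least vertex of a cycle would be the head of both cycle arcs at that vertex.
\<close>

lemma no_undirected_cycle_if_ranked:
  fixes r :: "'a \<Rightarrow> 'c::linorder"
  assumes wf: "wf_digraph G" and inj: "inj_on (head G) (arcs G)"
    and r: "\<And>e. e \<in> arcs G \<Longrightarrow> r (head G e) < r (tail G e)"
  shows "\<not> undirected_cycle G p"
proof
  assume cyc: "undirected_cycle G p"
  interpret B: wf_digraph "bidirect G" using wf by (rule wf_digraph_bidirect)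
  obtain u where u: "B.awalk u p u" "p \<noteq> []" and dist: "distinct (map fst p)"
    using cyc unfolding undirected_cycle_def B.cycle_def by blast
  have cas: "B.cas u p u" and sub: "fst ` set p \<subseteq> arcs G"
    using u unfolding B.awalk_def by auto
  let ?t = "\<lambda>a. r (tail (bidirect G) a)"
  \<comment> \<open>\<open>a\<close> leaves a vertex of least rank on the walk; every vertex of the
    walk is a tail because it is closed.\<close>
  obtain a where a: "a \<in> set p" and min: "\<And>c. c \<in> set p \<Longrightarrow> ?t a \<le> ?t c"
    using finite_has_minimal[of "?t ` set p"] u
    by (smt (verit) List.finite_set empty_is_image finite_imageI image_iff linorder_le_cases set_empty)
  have eq: "tail (bidirect G) ` set p = head (bidirect G) ` set p"
    by (rule B.closed_cas_tails_eq_heads[OF cas])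
  then obtain b where b: "b \<in> set p" "head (bidirect G) b = tail (bidirect G) a"
    using a by (metis image_iff)
  have "\<exists>c\<in>set p. tail (bidirect G) c = head (bidirect G) a"
    using a eq by (metis image_iff)
  then have "?t a \<le> r (head (bidirect G) a)" using min by force
  \<comment> \<open>Traversed forwards, \<open>a\<close> would reach a smaller rank. So it runs
    backwards.\<close>
  then have "head G (fst a) = tail (bidirect G) a"
    using r[of "fst a"] a sub by (cases a) (auto split: if_splits)
  \<comment> \<open>Traversed backwards, \<open>b\<close> would start at a smaller rank. So it runs
    forwards.\<close>
  moreover have "?t a \<le> ?t b" using min b by blast
  then have "head G (fst b) = tail (bidirect G) a"
    using r[of "fst b"] b sub by (cases b) (auto split: if_splits)
  ultimately have "fst a = fst b"
    using inj a b sub by (metis image_eqI inj_onD subsetD)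
  then have "a = b" using dist a b by (auto simp: distinct_map dest: inj_onD)
  \<comment> \<open>With \<open>a = b\<close> the arc would start and end at the same vertex, but
    its rank strictly decreases.\<close>
  then show False
    using b r[of "fst a"] a sub by (cases a) (auto split: if_splits)
qed

section \<open>Heavy spanning trees\<close>

lemma heavy_undirected_spanning_tree:
  fixes w :: "'a \<Rightarrow> real"
  assumes "digraph G" and con: "Digraph_Component.connected G"
    and w: "\<And>v. v \<in> verts G \<Longrightarrow> 0 \<le> w v"
  obtains T where "undirected_spanning_tree G T"
    "(\<Sum>v | v \<in> verts G \<and> in_degree G v \<noteq> 0. w v) \<le> 2 * (\<Sum>e\<in>T. w (head G e))"
proof -
  interpret digraph G by fact
  let ?S = "{v \<in> verts G. in_degree G v \<noteq> 0}"
  have "\<exists>e\<in>arcs G. head G e = v" if "v \<in> ?S" for v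
    using that by (auto simp: in_degree_def in_arcs_def)
  then obtain q where q: "\<And>v. v \<in> ?S \<Longrightarrow> q v \<in> arcs G \<and> head G (q v) = v"
    by metis
  obtain r :: "'a \<Rightarrow> nat" where r: "inj_on r (verts G)"
    using finite_imp_inj_to_nat_seg[OF finite_verts] by blast
  define F where "F R = {e \<in> q ` ?S. R (r (head G e)) (r (tail G e))}"
    for R :: "nat \<Rightarrow> nat \<Rightarrow> bool"
  have qS: "q ` ?S \<subseteq> arcs G" using q by auto
  have F: "F R \<subseteq> arcs G" for R using qS by (auto simp: F_def)
  have inj: "inj_on (head G) (q ` ?S)" using q by (auto intro!: inj_onI)
  have inj_q: "inj_on q ?S" using q by (intro inj_on_inverseI[of _ "head G"]) blast
  \<comment> \<open>Without loops, each chosen arc falls into exactly one of the two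
    classes.\<close>
  have "r (head G e) \<noteq> r (tail G e)" if "e \<in> arcs G" for e
    using inj_onD[OF r, of "head G e" "tail G e"] no_loops[OF that] that by auto
  then have split: "q ` ?S = F (<) \<union> F (>)" "F (<) \<inter> F (>) = {}"
    using qS by (force simp: F_def)+
  \<comment> \<open>The map \<open>s\<close> into the integers turns \<open>R\<close> into
    \<open><\<close>, so one proof covers both classes: \<open>int\<close> serves for
    \<open><\<close> and its negation for \<open>>\<close>.\<close>
  have forest: "\<not> undirected_cycle (G\<lparr>arcs := F R\<rparr>) p"
    if s: "\<And>x y. R x y \<longleftrightarrow> s x < s y" for R p and s :: "nat \<Rightarrow> int"
  proof (rule no_undirected_cycle_if_ranked)
    show "wf_digraph (G\<lparr>arcs := F R\<rparr>)" by (rule wf_digraph_arcs_update[OF wf_digraph F])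
    show "inj_on (head (G\<lparr>arcs := F R\<rparr>)) (arcs (G\<lparr>arcs := F R\<rparr>))"
      using inj by (auto simp: F_def intro: inj_on_subset)
    show "(s \<circ> r) (head (G\<lparr>arcs := F R\<rparr>) e) < (s \<circ> r) (tail (G\<lparr>arcs := F R\<rparr>) e)"
      if "e \<in> arcs (G\<lparr>arcs := F R\<rparr>)" for e
      using that s by (auto simp: F_def)
  qed
  have "(\<Sum>v\<in>?S. w v) = (\<Sum>e\<in>q ` ?S. w (head G e))"
    unfolding sum.reindex[OF inj_q] using q by (intro sum.cong) auto
  also have "\<dots> = (\<Sum>e\<in>F (<). w (head G e)) + (\<Sum>e\<in>F (>). w (head G e))"
    unfolding split(1) using F by (intro sum.union_disjoint split finite_subset[OF F finite_arcs])
  finally have sum: "(\<Sum>v\<in>?S. w v) = (\<Sum>e\<in>F (<). w (head G e)) + (\<Sum>e\<in>F (>). w (head G e))" .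
  obtain R where R: "R = (<) \<or> R = (>)"
    and half: "(\<Sum>v\<in>?S. w v) \<le> 2 * (\<Sum>e\<in>F R. w (head G e))"
  proof (cases "(\<Sum>e\<in>F (>). w (head G e)) \<le> (\<Sum>e\<in>F (<). w (head G e))")
    case True
    with sum show ?thesis by (intro that[of "(<)"]) auto
  next
    case False
    with sum show ?thesis by (intro that[of "(>)"]) auto
  qed
  have "\<nexists>p. undirected_cycle (G\<lparr>arcs := F R\<rparr>) p"
    using R forest[of "(<)" int] forest[of "(>)" "\<lambda>x. - int x"] by auto
  then obtain T where T: "F R \<subseteq> T" "undirected_spanning_tree G T"
    using forest_extends_to_spanning_tree[OF wf_digraph finite_arcs con F] by blast
  have "T \<subseteq> arcs G" using T unfolding undirected_spanning_tree_def by blast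
  \<comment> \<open>Nonnegative weights ensure that the arcs added to the forest cost
    nothing.\<close>
  then have "(\<Sum>e\<in>F R. w (head G e)) \<le> (\<Sum>e\<in>T. w (head G e))"
    using T w by (intro sum_mono2) (auto intro: finite_subset)
  with half have "(\<Sum>v\<in>?S. w v) \<le> 2 * (\<Sum>e\<in>T. w (head G e))" by linarith
  with T(2) show ?thesis by (rule that)
qed

section \<open>Degree entropy\<close>

context fin_digraph
begin

section \<open>Indegrees and the deletion of arcs\<close>

lemma sum_in_degree: "(\<Sum>v\<in>verts G. in_degree G v) = card (arcs G)"
proof -
  have "card (arcs G) = (\<Sum>v\<in>verts G. card {e \<in> arcs G. head G e = v})"
    by (subst card_eq_sum, subst sum.group[symmetric, of _ "verts G" "head G"]) auto
  then show ?thesis by (simp add: in_degree_def in_arcs_def)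
qed

lemma in_degree_le_card_arcs: "in_degree G v \<le> card (arcs G)"
  unfolding in_degree_def by (intro card_mono) auto

lemma fin_digraph_del_arcs: "fin_digraph (del_arcs G T)"
  by unfold_locales (auto simp: del_arcs_def)

lemma in_degree_del_arcs:
  assumes "T \<subseteq> arcs G"
  shows "real (in_degree (del_arcs G T) v) =
    real (in_degree G v) - real (card {e \<in> T. head G e = v})"
proof -
  have "in_arcs (del_arcs G T) v = in_arcs G v - {e \<in> T. head G e = v}"
    by (auto simp: del_arcs_def in_arcs_def)
  moreover have sub: "{e \<in> T. head G e = v} \<subseteq> in_arcs G v"
    using assms by auto
  ultimately show ?thesis
    using card_Diff_subset[OF finite_subset[OF sub finite_in_arcs] sub]
      card_mono[OF finite_in_arcs sub]
    by (simp add: in_degree_def of_nat_diff)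
qed

text \<open>Makes these logarithms admissible as vertex weights. At indegree \<open>0\<close> the
  conventions \<open>x / 0 = 0\<close> and \<open>ln 0 = 0\<close> give weight
  \<open>0\<close>.\<close>

lemma log_indegree_ratio_nonneg: "0 \<le> log 2 (real (card (arcs G)) / real (in_degree G v))"
proof (cases "in_degree G v = 0")
  case False
  then show ?thesis using in_degree_le_card_arcs[of v]
    by (subst zero_le_log_cancel_iff) (auto simp: field_simps)
qed (simp add: log_def)

text \<open>Gibbs bounds the new entropy by the cross entropy of the new indegrees against the old
  distribution. This is linear in the new indegrees, so each deleted arc removes exactly one
  logarithm.\<close>

lemma total_degree_entropy_del_arcs_le:
  assumes T: "T \<subseteq> arcs G"
  shows "total_degree_entropy (del_arcs G T) \<le> total_degree_entropy G -
    (\<Sum>e\<in>T. log 2 (real (card (arcs G)) / real (in_degree G (head G e))))"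
proof -
  let ?d = "\<lambda>v. real (in_degree G v)" and ?m = "real (card (arcs G))"
    and ?a = "\<lambda>v. real (in_degree (del_arcs G T) v)" and ?m' = "real (card (arcs (del_arcs G T)))"
  interpret D: fin_digraph "del_arcs G T" by (rule fin_digraph_del_arcs)
  have verts: "verts (del_arcs G T) = verts G" by (simp add: del_arcs_def)
  have finT: "finite T" using T by (auto intro: finite_subset)
  have sums: "(\<Sum>v\<in>verts G. ?d v) = ?m" "(\<Sum>v\<in>verts G. ?a v) = ?m'"
    using sum_in_degree D.sum_in_degree by (simp_all add: verts flip: of_nat_sum)
  \<comment> \<open>Termwise Gibbs, from \<open>ln x \<le> x - 1\<close> at
    \<open>x = ?m' * ?d v / (?a v * ?m)\<close>. The right-hand sides cancel in the sum over all
    vertices when \<open>?m\<close> is nonzero.\<close>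
  have gibbs: "?a v * log 2 (?m' / ?a v) - ?a v * log 2 (?m / ?d v) \<le> (?m' * ?d v / ?m - ?a v) / ln 2"
    for v
  proof (cases "?a v = 0")
    case False
    then have pos: "?a v > 0" "?d v \<ge> ?a v"
      using in_degree_del_arcs[OF T, of v] by auto
    then have "?d v > 0" by linarith
    moreover have "?m > 0" "?m' > 0"
      using calculation pos in_degree_le_card_arcs[of v] D.in_degree_le_card_arcs[of v] by linarith+
    ultimately have "?a v * ln (?m' * ?d v / (?a v * ?m)) \<le> ?a v * (?m' * ?d v / (?a v * ?m) - 1)"
      using pos by (intro mult_left_mono ln_le_minus_one) auto
    also have "\<dots> = ?m' * ?d v / ?m - ?a v" using pos by (simp add: field_simps)
    finally have "?a v * ln (?m' * ?d v / (?a v * ?m)) / ln 2 \<le> (?m' * ?d v / ?m - ?a v) / ln 2"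
      by (simp add: divide_right_mono)
    moreover have "ln (?m' * ?d v / (?a v * ?m)) = ln (?m' / ?a v) - ln (?m / ?d v)"
    proof -
      have "?m' * ?d v / (?a v * ?m) = (?m' / ?a v) / (?m / ?d v)" by simp
      then show ?thesis
        using ln_divide_pos pos \<open>?d v > 0\<close> \<open>?m > 0\<close> \<open>?m' > 0\<close> by (metis divide_pos_pos)
    qed
    ultimately show ?thesis by (simp add: log_def right_diff_distrib diff_divide_distrib)
  qed simp
  have "total_degree_entropy (del_arcs G T) - (\<Sum>v\<in>verts G. ?a v * log 2 (?m / ?d v))
      \<le> (\<Sum>v\<in>verts G. (?m' * ?d v / ?m - ?a v) / ln 2)"
    unfolding total_degree_entropy_def verts sum_subtractf[symmetric]
    by (intro sum_mono gibbs)
  also have "\<dots> = (?m' * ?m / ?m - ?m') / ln 2"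
    by (simp add: sums sum_subtractf flip: sum_divide_distrib sum_distrib_left)
  \<comment> \<open>For \<open>?m = 0\<close> the quotient is \<open>0\<close> and
    \<open>- ?m' / ln 2\<close> remains.\<close>
  also have "\<dots> \<le> 0" by (cases "?m = 0") (auto intro: divide_nonpos_nonneg)
  finally have "total_degree_entropy (del_arcs G T) \<le> (\<Sum>v\<in>verts G. ?a v * log 2 (?m / ?d v))"
    by simp
  also have "\<dots> = total_degree_entropy G -
      (\<Sum>v\<in>verts G. real (card {e \<in> T. head G e = v}) * log 2 (?m / ?d v))"
    unfolding total_degree_entropy_def
    by (simp add: in_degree_del_arcs[OF T] left_diff_distrib sum_subtractf)
  also have "(\<Sum>v\<in>verts G. real (card {e \<in> T. head G e = v}) * log 2 (?m / ?d v)) =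
      (\<Sum>v\<in>verts G. \<Sum>e | e \<in> T \<and> head G e = v. log 2 (?m / ?d (head G e)))"
    by (intro sum.cong refl) simp
  also have "\<dots> = (\<Sum>e\<in>T. log 2 (?m / ?d (head G e)))"
    using T finT by (intro sum.group) auto
  finally show ?thesis .
qed

text \<open>
  Chebyshev's sum inequality, as the indegree and the logarithm are oppositely ordered: compare
  both factors with their values at the average indegree.
\<close>

lemma card_mult_degree_entropy_le:
  "real (card {v \<in> verts G. in_degree G v \<noteq> 0}) * degree_entropy G \<le>
    (\<Sum>v | v \<in> verts G \<and> in_degree G v \<noteq> 0. log 2 (real (card (arcs G)) / real (in_degree G v)))"
proof -
  let ?d = "\<lambda>v. real (in_degree G v)" and ?m = "real (card (arcs G))"
    and ?S = "{v \<in> verts G. in_degree G v \<noteq> 0}"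
  let ?k = "real (card ?S)" and ?L = "\<lambda>v. log 2 (?m / ?d v)"
  show ?thesis
  proof (cases "?m = 0")
    \<comment> \<open>Division by zero makes the entropy \<open>0\<close>, and every weight is
      \<open>log 2 0 = 0\<close>.\<close>
    case True
    then show ?thesis by (simp add: degree_entropy_eq log_def)
  next
    case False
    then have m: "?m > 0" by linarith
    have sumS: "(\<Sum>v\<in>?S. ?d v) = ?m"
      unfolding sum_in_degree[symmetric] of_nat_sum by (rule sum.mono_neutral_left) auto
    with m have k: "?k > 0" by (auto simp: card_gt_0_iff intro!: Nat.gr0I)
    \<comment> \<open>The average indegree over the vertices of nonzero indegree.\<close>
    define c where "c = ?m / ?k"
    have c: "c > 0" using m k by (simp add: c_def)
    have "(?d v - c) * (?L v - log 2 (?m / c)) \<le> 0" if "v \<in> ?S" for v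
    proof -
      have d: "?d v > 0" using that by simp
      show ?thesis
      proof (cases "?d v \<le> c")
        case True
        then have "log 2 (?m / c) \<le> ?L v" using d c m by (simp add: frac_le)
        with True show ?thesis by (simp add: mult_nonpos_nonneg)
      next
        case False
        then have "?L v \<le> log 2 (?m / c)" using d c m by (simp add: frac_le)
        with False show ?thesis by (simp add: mult_nonneg_nonpos)
      qed
    qed
    then have "(\<Sum>v\<in>?S. (?d v - c) * (?L v - log 2 (?m / c))) \<le> 0" by (rule sum_nonpos)
    moreover have "(\<Sum>v\<in>?S. (?d v - c) * (?L v - log 2 (?m / c))) =
        (\<Sum>v\<in>?S. ?d v * ?L v) - c * (\<Sum>v\<in>?S. ?L v) - (\<Sum>v\<in>?S. ?d v - c) * log 2 (?m / c)"
      by (simp add: algebra_simps sum.distrib sum_subtractf sum_distrib_left sum_distrib_right)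
    \<comment> \<open>Deviations from the average cancel, which removes the constant
      \<open>log 2 (?m / c)\<close>.\<close>
    moreover have "(\<Sum>v\<in>?S. ?d v - c) = 0"
      unfolding sum_subtractf sumS c_def sum_constant using k
      by (simp only: nonzero_mult_div_cancel_left times_divide_eq_right less_imp_neq[symmetric]
          diff_self not_False_eq_True)
    moreover have "(\<Sum>v\<in>?S. ?d v * ?L v) = total_degree_entropy G"
      unfolding total_degree_entropy_def by (rule sum.mono_neutral_left) auto
    ultimately have "total_degree_entropy G \<le> c * (\<Sum>v\<in>?S. ?L v)" by simp
    then show ?thesis using m k by (simp add: degree_entropy_eq c_def field_simps)
  qed
qed

lemma degree_entropy_nonneg: "0 \<le> degree_entropy G"
  unfolding degree_entropy_def
  by (intro sum_nonneg mult_nonneg_nonneg log_indegree_ratio_nonneg) auto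

end

theorem theorem7:
  fixes G :: "('a, 'b) pre_digraph" and n :: nat and \<alpha> :: real
  assumes "digraph G"
    and "Digraph_Component.connected G"
    and "n = card (verts G)"
    and "\<alpha> > 0"
    and "real (card {v \<in> verts G. in_degree G v \<noteq> 0}) \<ge> real n / \<alpha>"
  shows "\<exists>T. undirected_spanning_tree G T \<and>
    total_degree_entropy (del_arcs G T) \<le>
      total_degree_entropy G - real n / (2 * \<alpha>) * degree_entropy G + 2 * real n / ln 2"
proof -
  interpret digraph G by fact
  let ?w = "\<lambda>v. log 2 (real (card (arcs G)) / real (in_degree G v))"
  obtain T where T: "undirected_spanning_tree G T"
    and heavy: "(\<Sum>v | v \<in> verts G \<and> in_degree G v \<noteq> 0. ?w v) \<le> 2 * (\<Sum>e\<in>T. ?w (head G e))"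
    using heavy_undirected_spanning_tree[OF assms(1,2), of ?w] log_indegree_ratio_nonneg by blast
  \<comment> \<open>The chain ends in twice the weight of \<open>T\<close>; halving it produces the
    factor \<open>n / (2 * \<alpha>)\<close>.\<close>
  have "real n / \<alpha> * degree_entropy G \<le>
      real (card {v \<in> verts G. in_degree G v \<noteq> 0}) * degree_entropy G"
    by (intro mult_right_mono assms(5) degree_entropy_nonneg)
  also note card_mult_degree_entropy_le
  also note heavy
  finally have "real n / (2 * \<alpha>) * degree_entropy G \<le> (\<Sum>e\<in>T. ?w (head G e))"
    by (simp add: field_simps)
  moreover have "total_degree_entropy (del_arcs G T) \<le>
      total_degree_entropy G - (\<Sum>e\<in>T. ?w (head G e))"
    using T by (intro total_degree_entropy_del_arcs_le) (simp add: undirected_spanning_tree_def)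
  moreover have "0 \<le> 2 * real n / ln 2" by simp
  ultimately show ?thesis using T by (intro exI[of _ T]) linarith
qed

end
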